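(* Let $k$ be a field, $V$ a $k$-vector space, and $X \subseteq \mathrm{End}_k(V)$ a finite commutative collection of transformations (i.e. $X$ is a finite set whose elements commute pairwise). If each element of $X$ is triangularizable, then there exists a well-ordered basis for $V$ with respect to which every element of $X$ is triangular.
   Context: $V$ has arbitrary dimension. $\mathrm{End}_k(V)$ is the $k$-algebra of all linear transformations of $V$, and $\langle Y\rangle$ is the subspace generated by a subset $Y$ of $V$. Given a basis $\mathcal{B}$ for $V$ and a partial order $\leq$ on $\mathcal{B}$, $T \in \mathrm{End}_k(V)$ is triangular with respect to $(\mathcal{B}, \leq)$ if $T(v) \in \langle \{u \in \mathcal{B} \mid u \leq v\} \rangle$ for all $v \in \mathcal{B}$. $T$ is triangularizable if it is triangular with respect to some well-ordered basis for $V$. *)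

theory Defs
  imports Complex_Main
begin

definition is_basis :: "('k::field \<Rightarrow> 'v::ab_group_add \<Rightarrow> 'v) \<Rightarrow> 'v set \<Rightarrow> bool" where
  "is_basis scale B \<longleftrightarrow> \<not> module.dependent scale B \<and> module.span scale B = UNIV"

text \<open>
  An order on \<open>B\<close> is a relation \<open>r\<close> with \<open>(u, v) \<in> r\<close> meaning \<open>u \<le> v\<close>. The predicate
  \<open>triangular\<close> is meant for a basis \<open>B\<close>, a partial order \<open>r\<close> on \<open>B\<close> and a linear map \<open>T\<close>;
  it does not impose these conditions itself.
\<close>

definition triangular ::
    "('k::field \<Rightarrow> 'v::ab_group_add \<Rightarrow> 'v) \<Rightarrow> 'v set \<Rightarrow> 'v rel \<Rightarrow> ('v \<Rightarrow> 'v) \<Rightarrow> bool" where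
  "triangular scale B r T \<longleftrightarrow> (\<forall>v\<in>B. T v \<in> module.span scale {u \<in> B. (u, v) \<in> r})"

definition triangularizable ::
    "('k::field \<Rightarrow> 'v::ab_group_add \<Rightarrow> 'v) \<Rightarrow> ('v \<Rightarrow> 'v) \<Rightarrow> bool" where
  "triangularizable scale T \<longleftrightarrow>
     (\<exists>B r. is_basis scale B \<and> well_order_on B r \<and> triangular scale B r T)"

end

theory Submission
  imports Defs
begin

text \<open>
  A triangularizable \<open>T\<close> is locally split algebraic: every vector is sent to \<open>0\<close> by some product
  of factors \<open>T - a\<close>. Hence, modulo an invariant proper subspace \<open>W\<close>, applying the factors one
  at a time to a vector outside \<open>W\<close> meets an eigenvector of \<open>T\<close> just before \<open>W\<close> is entered. Maps
  commuting with \<open>T\<close> keep their eigenvectors modulo \<open>W\<close> along the way, so finitely many commuting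
  maps have a common eigenvector modulo \<open>W\<close>. By Zorn's lemma there is a well-ordered independent
  set, triangular for all the maps, that no longer well-ordered set extends at its end; it spans
  \<open>V\<close>, since otherwise a common eigenvector modulo its span could be appended.
\<close>

subsection \<open>Well-orders\<close>

text \<open>Inclusion alone could create infinite descents in the union. For initial segments
  nothing new appears below an old element, so the strict parts form a chain with well-founded
  union.\<close>

lemma Well_order_Union_init_segs:
  assumes "R \<in> Chains init_seg_of" and wo: "\<forall>r\<in>R. Well_order r"
  shows "Well_order (\<Union>R)"
proof -
  have chain: "chain\<^sub>\<subseteq> R"
    using assms(1) by (auto simp: init_seg_of_def chain_subset_def Chains_def)
  have parts: "\<forall>r\<in>R. Refl r" "\<forall>r\<in>R. trans r" "\<forall>r\<in>R. antisym r" "\<forall>r\<in>R. Total r"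
    "\<forall>r\<in>R. wf (r - Id)"
    using wo by (simp_all add: order_on_defs)
  have "Refl (\<Union>R)"
    using parts(1) unfolding refl_on_def by fastforce
  moreover have "\<Union>R - Id = \<Union>{r - Id |r. r \<in> R}"
    by blast
  then have "wf (\<Union>R - Id)"
    using wf_Union_wf_init_segs[OF Chains_inits_DiffI[OF assms(1)]] parts(5) by fastforce
  moreover have "\<Union>R \<subseteq> Field (\<Union>R) \<times> Field (\<Union>R)"
    unfolding Field_def by auto
  ultimately show ?thesis
    using chain_subset_trans_Union[OF chain parts(2)] chain_subset_antisym_Union[OF chain parts(3)]
      chain_subset_Total_Union[OF chain parts(4)]
    by (simp add: order_on_defs)
qed

text \<open>Zorn's lemma for the initial segment order, with unions as upper bounds. The empty chain
  is among the chains, so \<open>Union\<close> also yields \<open>P {}\<close>.\<close>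

lemma maximal_Well_order:
  fixes P :: "'a rel \<Rightarrow> bool"
  assumes Union: "\<And>R. R \<in> Chains init_seg_of \<Longrightarrow> \<forall>r\<in>R. Well_order r \<and> P r \<Longrightarrow> P (\<Union>R)"
  obtains m where "Well_order m" "P m"
    "\<And>r. Well_order r \<Longrightarrow> P r \<Longrightarrow> m initial_segment_of r \<Longrightarrow> r = m"
proof -
  define A where "A = {r. Well_order r \<and> P r}"
  define I where "I = init_seg_of \<inter> A \<times> A"
  have Field_I: "Field I = A"
    by (auto simp: I_def init_seg_of_def Field_def)
  have order: "Partial_order I"
    unfolding partial_order_on_def preorder_on_def Field_I
  proof (intro conjI)
    show "I \<subseteq> A \<times> A"
      by (simp add: I_def)
    show "refl_on A I"
      by (simp add: refl_on_def I_def)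
    show "trans I"
      using trans_init_seg_of unfolding trans_def I_def by blast
    show "antisym I"
      using antisym_init_seg_of unfolding antisym_def I_def by blast
  qed
  have bound: "\<exists>u\<in>Field I. \<forall>r\<in>R. (r, u) \<in> I" if "R \<in> Chains I" for R
  proof -
    have chain: "R \<in> Chains init_seg_of"
      using that mono_Chains[of I init_seg_of] unfolding I_def by blast
    have sub: "R \<subseteq> A"
      using that unfolding Chains_def I_def by blast
    then have "\<forall>r\<in>R. Well_order r \<and> P r"
      unfolding A_def by blast
    then have "\<Union>R \<in> A"
      using Well_order_Union_init_segs[OF chain] Union[OF chain] unfolding A_def by blast
    moreover have "(r, \<Union>R) \<in> I" if "r \<in> R" for r
      using Chains_init_seg_of_Union[OF chain that] sub that \<open>\<Union>R \<in> A\<close> by (auto simp: I_def)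
    ultimately show ?thesis
      unfolding Field_I by blast
  qed
  obtain m where m: "m \<in> Field I" "\<forall>r\<in>Field I. (m, r) \<in> I \<longrightarrow> r = m"
    using Zorns_po_lemma[OF order bound] by blast
  show thesis
  proof
    show "Well_order m" "P m"
      using m(1) unfolding Field_I A_def by blast+
    show "r = m" if "Well_order r" "P r" "m initial_segment_of r" for r
    proof -
      have "r \<in> Field I" "(m, r) \<in> I"
        using that m(1) unfolding Field_I by (simp_all add: I_def A_def)
      then show ?thesis
        using m(2) by blast
    qed
  qed
qed

lemma Well_order_append:
  fixes r :: "'a rel" and x :: 'a
  assumes "Well_order r" and x: "x \<notin> Field r"
  defines "s \<equiv> r \<union> insert x (Field r) \<times> {x}"
  shows "Well_order s" "Field s = insert x (Field r)" "r initial_segment_of s"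
proof -
  show Field_s: "Field s = insert x (Field r)"
    by (auto simp: s_def Field_def)
  have r: "Refl r" "trans r" "antisym r" "Total r" "wf (r - Id)"
    using assms(1) by (simp_all add: order_on_defs)
  have "s \<subseteq> Field s \<times> Field s"
    unfolding Field_def by auto
  moreover have "Refl s"
    using r(1) unfolding refl_on_def Field_s unfolding s_def by blast
  moreover have "trans s"
    using r(2) x unfolding trans_def s_def Field_def by blast
  moreover have "antisym s"
    using r(3) x unfolding antisym_def s_def Field_def by blast
  moreover have "Total s"
    using r(4) unfolding total_on_def Field_s unfolding s_def by blast
  moreover have "wf (s - Id)"
  proof -
    \<comment> \<open>No strict pair starts at the new top \<open>x\<close>: the added pairs cannot
      be chained, and no old pair continues one of them.\<close>
    have "wf (Field r \<times> {x})"
      using x by (intro wf_no_loop) auto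
    then have "wf ((r - Id) \<union> Field r \<times> {x})"
      using r(5) x by (intro wf_Un) (auto simp: Field_def)
    then show ?thesis
      by (rule wf_subset) (auto simp: s_def)
  qed
  ultimately show "Well_order s"
    by (simp add: order_on_defs)
  show "r initial_segment_of s"
    using x by (auto simp: init_seg_of_def s_def Field_def)
qed

subsection \<open>Locally split algebraic maps\<close>

text \<open>For linear \<open>T\<close>, this is torsion by split polynomials, with \<open>V\<close>
  a module over \<open>k[x]\<close> on which \<open>x\<close> acts as \<open>T\<close>. Instead of a
  polynomial, the rules record one linear factor at a time, so that induction follows the successive
  images of \<open>v\<close>.\<close>

inductive split_torsion ::
    "('k::field \<Rightarrow> 'v::ab_group_add \<Rightarrow> 'v) \<Rightarrow> ('v \<Rightarrow> 'v) \<Rightarrow> 'v \<Rightarrow> bool" for scale T where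
  zero: "split_torsion scale T 0"
| step: "split_torsion scale T (T v - scale a v) \<Longrightarrow> split_torsion scale T v"

context vector_space
begin

lemma linear_factor:
  assumes "Vector_Spaces.linear scale scale T"
  shows "T (v + w) - scale a (v + w) = (T v - scale a v) + (T w - scale a w)"
    and "T (scale c v) - scale a (scale c v) = scale c (T v - scale a v)"
    and "T (T v - scale b v) - scale a (T v - scale b v)
          = T (T v - scale a v) - scale b (T v - scale a v)"
proof -
  interpret T: Vector_Spaces.linear scale scale T by fact
  show "T (v + w) - scale a (v + w) = (T v - scale a v) + (T w - scale a w)"
    by (simp add: T.add scale_right_distrib)
  show "T (scale c v) - scale a (scale c v) = scale c (T v - scale a v)"
    by (simp add: T.scale scale_right_diff_distrib mult.commute)
  show "T (T v - scale b v) - scale a (T v - scale b v)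
          = T (T v - scale a v) - scale b (T v - scale a v)"
    by (simp add: T.scale T.diff scale_right_diff_distrib mult.commute)
qed

text \<open>The factors commute, so the product that kills \<open>v\<close> also kills its image
  under \<open>T - a\<close>.\<close>

lemma split_torsion_factor:
  assumes T: "Vector_Spaces.linear scale scale T" and "split_torsion scale T v"
  shows "split_torsion scale T (T v - scale a v)"
  using assms(2)
proof induction
  case zero
  have "T 0 = 0"
    using linear_factor(2)[OF T, of 0 0 0] by simp
  then show ?case
    by (simp add: split_torsion.zero)
next
  case (step v b)
  then show ?case
    using split_torsion.step[of scale T "T v - scale a v" b] linear_factor(3)[OF T, of v b a] by simp
qed

text \<open>The product of the factors for \<open>v\<close> and those for \<open>w\<close> kills the
  sum. Each factor spent on \<open>v\<close> also moves \<open>w\<close>, hence the induction with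
  \<open>w\<close> arbitrary.\<close>

lemma split_torsion_add:
  assumes T: "Vector_Spaces.linear scale scale T" and "split_torsion scale T v" "split_torsion scale T w"
  shows "split_torsion scale T (v + w)"
  using assms(2,3)
proof (induction arbitrary: w)
  case zero
  then show ?case by simp
next
  case (step v a)
  show ?case
    using step.IH[OF split_torsion_factor[OF T step.prems, of a]]
    by (intro split_torsion.step[of scale T "v + w" a]) (simp add: linear_factor(1)[OF T])
qed

lemma split_torsion_scale:
  assumes T: "Vector_Spaces.linear scale scale T" and "split_torsion scale T v"
  shows "split_torsion scale T (scale c v)"
  using assms(2)
proof induction
  case zero
  then show ?case by (simp add: split_torsion.zero)
next
  case (step v a)
  then show ?case
    by (intro split_torsion.step[of scale T "scale c v" a])
      (simp only: linear_factor(2)[OF T])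
qed

lemma subspace_split_torsion:
  assumes "Vector_Spaces.linear scale scale T"
  shows "subspace {v. split_torsion scale T v}"
  using assms by (auto intro: subspaceI split_torsion.zero split_torsion_add split_torsion_scale)

text \<open>Well-founded induction along the basis: subtracting the diagonal coefficient leaves a
  combination of strictly smaller basis vectors, which are torsion already.\<close>

lemma triangularizable_imp_split_torsion:
  assumes T: "Vector_Spaces.linear scale scale T" and "triangularizable scale T"
  shows "split_torsion scale T v"
proof -
  obtain B r where B: "span B = UNIV" and r: "well_order_on B r" and tri: "triangular scale B r T"
    using assms(2) unfolding triangularizable_def is_basis_def by blast
  have "v \<in> B \<longrightarrow> split_torsion scale T v" for v
  proof (rule wf_induct_rule[of "r - Id"])
    show "wf (r - Id)"
      using r by (simp add: well_order_on_def)
    fix v assume IH: "\<And>u. (u, v) \<in> r - Id \<Longrightarrow> u \<in> B \<longrightarrow> split_torsion scale T u"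
    show "v \<in> B \<longrightarrow> split_torsion scale T v"
    proof
      assume "v \<in> B"
      then have "T v \<in> span {u \<in> B. (u, v) \<in> r}"
        using tri by (simp add: triangular_def)
      also have "\<dots> \<subseteq> span (insert v {u \<in> B. (u, v) \<in> r - Id})"
        by (intro span_mono) auto
      finally obtain a where "T v - scale a v \<in> span {u \<in> B. (u, v) \<in> r - Id}"
        unfolding span_breakdown_eq by blast
      also have "\<dots> \<subseteq> {u. split_torsion scale T u}"
        using IH by (intro span_minimal subspace_split_torsion[OF T]) blast
      finally show "split_torsion scale T v"
        by (auto intro: split_torsion.step)
    qed
  qed
  then have "span B \<subseteq> {u. split_torsion scale T u}"
    by (intro span_minimal subspace_split_torsion[OF T]) blast
  then show ?thesis
    using B by auto
qed

subsection \<open>Common eigenvectors modulo an invariant subspace\<close>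

text \<open>The factors lead from \<open>v\<close> to \<open>0\<close>, which lies in
  \<open>W\<close>, and \<open>P\<close> persists while \<open>W\<close> is avoided. So some factor
  takes a vector with \<open>P\<close> into \<open>W\<close>.\<close>

lemma split_torsion_last_before:
  assumes "split_torsion scale T v" and "P v" and "0 \<in> W"
    and "\<And>w. P w \<Longrightarrow> w \<notin> W"
    and "\<And>w a. P w \<Longrightarrow> T w - scale a w \<notin> W \<Longrightarrow> P (T w - scale a w)"
  shows "\<exists>w a. P w \<and> T w - scale a w \<in> W"
  using assms(1,2) by induction (use assms(3-5) in blast)+

text \<open>Eigenvectors in the quotient by \<open>W\<close> are expressed as congruences in
  \<open>V\<close>. Induction on \<open>Y\<close>: start from a common eigenvector of the smaller
  set and apply factors of the new map \<open>T\<close>.\<close>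

lemma common_eigenvector_mod_subspace:
  assumes "finite Y"
    and lin: "\<And>T. T \<in> Y \<Longrightarrow> Vector_Spaces.linear scale scale T"
    and comm: "\<And>S T. S \<in> Y \<Longrightarrow> T \<in> Y \<Longrightarrow> S \<circ> T = T \<circ> S"
    and tors: "\<And>T v. T \<in> Y \<Longrightarrow> split_torsion scale T v"
    and W: "subspace W" "W \<noteq> UNIV"
    and inv: "\<And>T v. T \<in> Y \<Longrightarrow> v \<in> W \<Longrightarrow> T v \<in> W"
  shows "\<exists>v. v \<notin> W \<and> (\<forall>T\<in>Y. \<exists>a. T v - scale a v \<in> W)"
  using assms
proof (induction Y rule: finite_induct)
  case empty
  then show ?case by auto
next
  case (insert T Y)
  define P where "P v \<longleftrightarrow> v \<notin> W \<and> (\<forall>S\<in>Y. \<exists>b. S v - scale b v \<in> W)" for v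
  have "\<exists>v. P v"
    unfolding P_def
  proof (rule insert.IH)
    show "S \<circ> T = T \<circ> S" if "S \<in> Y" "T \<in> Y" for S T
      using insert.prems(2)[OF insertI2[OF that(1)] insertI2[OF that(2)]] .
  qed (use insert.prems(1,3,6) W in blast)+
  then obtain v where "P v" ..
  have step: "P (T w - scale a w)" if w: "P w" and "T w - scale a w \<notin> W" for w a
  proof -
    have "\<exists>b. S (T w - scale a w) - scale b (T w - scale a w) \<in> W" if "S \<in> Y" for S
    proof -
      interpret S: Vector_Spaces.linear scale scale S
        using insert.prems(1) \<open>S \<in> Y\<close> by simp
      interpret T: Vector_Spaces.linear scale scale T
        using insert.prems(1) by simp
      obtain b where b: "S w - scale b w \<in> W"
        using w \<open>S \<in> Y\<close> unfolding P_def by blast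
      have ST: "S (T w) = T (S w)"
        using o_eq_dest[OF insert.prems(2)[OF insertI2[OF \<open>S \<in> Y\<close>] insertI1]] .
      \<comment> \<open>\<open>S - b\<close> commutes with \<open>T - a\<close>, which maps
        \<open>W\<close> into itself; thus \<open>S\<close> keeps its eigenvalue
        \<open>b\<close>.\<close>
      have "S (T w - scale a w) - scale b (T w - scale a w)
          = T (S w - scale b w) - scale a (S w - scale b w)"
        by (simp add: ST S.diff S.scale T.diff T.scale scale_right_diff_distrib mult.commute)
      also have "\<dots> \<in> W"
        using subspace_diff[OF W(1) insert.prems(6)[OF insertI1 b] subspace_scale[OF W(1) b]] .
      finally show ?thesis ..
    qed
    then show ?thesis
      using that unfolding P_def by blast
  qed
  have "\<exists>w a. P w \<and> T w - scale a w \<in> W"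
  proof (rule split_torsion_last_before[of T v])
    show "w \<notin> W" if "P w" for w
      using that unfolding P_def ..
  qed (use insert.prems(3) \<open>P v\<close> step subspace_0[OF W(1)] in blast)+
  then show ?case
    unfolding P_def by auto
qed

subsection \<open>Construction of the basis\<close>

lemma triangular_span_invariant:
  assumes "Vector_Spaces.linear scale scale T" and tri: "triangular scale B r T"
    and "v \<in> span B"
  shows "T v \<in> span B"
proof -
  interpret T: Vector_Spaces.linear scale scale T by fact
  have "T u \<in> span B" if "u \<in> B" for u
    using tri that span_mono[of "{x \<in> B. (x, u) \<in> r}" B] unfolding triangular_def by blast
  then have "span (T ` B) \<subseteq> span B"
    by (intro span_minimal subspace_span) auto
  then show ?thesis
    using \<open>v \<in> span B\<close> T.span_image[of B] by blast
qed

lemma triangular_Union: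
  assumes "\<And>r. r \<in> R \<Longrightarrow> triangular scale (Field r) r T"
  shows "triangular scale (Field (\<Union>R)) (\<Union>R) T"
  unfolding triangular_def
proof
  fix v assume "v \<in> Field (\<Union>R)"
  then obtain r where r: "r \<in> R" "v \<in> Field r"
    by (auto simp: Field_def)
  then have "T v \<in> span {u \<in> Field r. (u, v) \<in> r}"
    using assms unfolding triangular_def by blast
  also have "\<dots> \<subseteq> span {u \<in> Field (\<Union>R). (u, v) \<in> \<Union>R}"
    using r(1) by (intro span_mono) (auto simp: Field_def)
  finally show "T v \<in> span {u \<in> Field (\<Union>R). (u, v) \<in> \<Union>R}" .
qed

text \<open>Everything lies below the new top \<open>v\<close>, so \<open>T v\<close> may involve
  all of \<open>B\<close> and \<open>v\<close> itself; the conditions at older vectors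
  persist.\<close>

lemma triangular_append:
  assumes tri: "triangular scale B r T" and v: "T v - scale a v \<in> span B"
  shows "triangular scale (insert v B) (r \<union> insert v B \<times> {v}) T"
  unfolding triangular_def
proof
  fix u assume u: "u \<in> insert v B"
  show "T u \<in> span {x \<in> insert v B. (x, u) \<in> r \<union> insert v B \<times> {v}}"
  proof (cases "u = v")
    case True
    then have "{x \<in> insert v B. (x, u) \<in> r \<union> insert v B \<times> {v}} = insert v B"
      by auto
    then show ?thesis
      using v True span_breakdown_eq[of "T v" v B] by auto
  next
    case False
    then have "T u \<in> span {x \<in> B. (x, u) \<in> r}"
      using tri u unfolding triangular_def by blast
    then show ?thesis
      using span_mono[of "{x \<in> B. (x, u) \<in> r}"
          "{x \<in> insert v B. (x, u) \<in> r \<union> insert v B \<times> {v}}"] by auto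
  qed
qed

lemma simultaneously_triangularizable:
  assumes "finite X"
    and lin: "\<And>T. T \<in> X \<Longrightarrow> Vector_Spaces.linear scale scale T"
    and comm: "\<And>S T. S \<in> X \<Longrightarrow> T \<in> X \<Longrightarrow> S \<circ> T = T \<circ> S"
    and tors: "\<And>T v. T \<in> X \<Longrightarrow> split_torsion scale T v"
  shows "\<exists>B r. is_basis scale B \<and> well_order_on B r \<and> (\<forall>T\<in>X. triangular scale B r T)"
proof -
  \<comment> \<open>The independent set is carried as \<open>Field r\<close>, so that Zorn's lemma
    deals with relations only. Reflexivity of a well-order keeps even a single vector in its
    field.\<close>
  define P where
    "P r \<longleftrightarrow> independent (Field r) \<and> (\<forall>T\<in>X. triangular scale (Field r) r T)" for r
  have "P (\<Union>R)" if "R \<in> Chains init_seg_of" and "\<forall>r\<in>R. Well_order r \<and> P r" for R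
  proof -
    have "Field (\<Union>R) = \<Union>(Field ` R)"
      by (auto simp: Field_def)
    moreover have "independent (\<Union>(Field ` R))"
    proof (rule independent_Union_directed)
      show "c \<subseteq> d \<or> d \<subseteq> c" if cd: "c \<in> Field ` R" "d \<in> Field ` R" for c d
      proof -
        obtain r s where rs: "r \<in> R" "s \<in> R" "c = Field r" "d = Field s"
          using cd by blast
        then have "r \<subseteq> s \<or> s \<subseteq> r"
          using \<open>R \<in> Chains init_seg_of\<close> by (auto simp: Chains_def init_seg_of_def)
        then show ?thesis
          using rs mono_Field by blast
      qed
    qed (use that in \<open>auto simp: P_def\<close>)
    moreover have "triangular scale (Field (\<Union>R)) (\<Union>R) T" if "T \<in> X" for T
      using \<open>\<forall>r\<in>R. Well_order r \<and> P r\<close> that by (intro triangular_Union) (simp add: P_def)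
    ultimately show ?thesis
      by (simp add: P_def)
  qed
  then obtain m where m: "Well_order m" "P m"
    and max: "\<And>r. Well_order r \<Longrightarrow> P r \<Longrightarrow> m initial_segment_of r \<Longrightarrow> r = m"
    using maximal_Well_order[of P] by blast
  define B where "B = Field m"
  have tri: "triangular scale B m T" if "T \<in> X" for T
    using m(2) that by (simp add: P_def B_def)
  have "span B = UNIV"
  proof (rule ccontr)
    assume "span B \<noteq> UNIV"
    then obtain v where v: "v \<notin> span B" "\<forall>T\<in>X. \<exists>a. T v - scale a v \<in> span B"
      using common_eigenvector_mod_subspace[OF \<open>finite X\<close> lin comm tors subspace_span[of B]]
        triangular_span_invariant[OF lin tri] by blast
    \<comment> \<open>Placing \<open>v\<close> above all of \<open>B\<close> keeps \<open>m\<close>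
      an initial segment, so maximality would force \<open>v\<close> into \<open>B\<close>.\<close>
    define s where "s = m \<union> insert v B \<times> {v}"
    have "v \<notin> B"
      using v(1) span_base by blast
    then have s: "Well_order s" "Field s = insert v B" "m initial_segment_of s"
      using Well_order_append[OF m(1), of v] by (simp_all add: s_def B_def)
    have "P s"
      unfolding P_def s(2)
    proof
      show "independent (insert v B)"
        using m(2) v(1) by (simp add: P_def B_def independent_insertI)
      show "\<forall>T\<in>X. triangular scale (insert v B) s T"
        using v(2) tri triangular_append unfolding s_def by blast
    qed
    then have "s = m"
      using max s by blast
    then show False
      using s(2) \<open>v \<notin> B\<close> B_def by blast
  qed
  then have "is_basis scale B"
    using m(2) by (simp add: is_basis_def P_def B_def)
  then show ?thesis
    using m(1) tri B_def by blast
qed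

end

theorem theorem15:
  fixes scale :: "'k::field \<Rightarrow> 'v::ab_group_add \<Rightarrow> 'v"
    and X :: "('v \<Rightarrow> 'v) set"
  assumes "vector_space scale"
    and "X \<subseteq> {T. Vector_Spaces.linear scale scale T}"
    and "finite X"
    and "\<forall>S\<in>X. \<forall>T\<in>X. S \<circ> T = T \<circ> S"
    and "\<forall>T\<in>X. triangularizable scale T"
  shows "\<exists>B r. is_basis scale B \<and> well_order_on B r \<and>
           (\<forall>T\<in>X. triangular scale B r T)"
proof -
  interpret vector_space scale by fact
  have lin: "Vector_Spaces.linear scale scale T" if "T \<in> X" for T
    using assms(2) that by blast
  show ?thesis
  proof (rule simultaneously_triangularizable[OF assms(3) lin])
    show "S \<circ> T = T \<circ> S" if "S \<in> X" "T \<in> X" for S T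
      using assms(4)[rule_format, OF that] .
    \<comment> \<open>The bases of the individual maps are discarded here; they contribute only that
      all vectors are split torsion.\<close>
    show "split_torsion scale T v" if "T \<in> X" for T v
      using triangularizable_imp_split_torsion[OF lin[OF that]] assms(5) that by blast
  qed
qed

end
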